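(* Let $\{\beta_{ij}\}_{i,j=0}^\infty$ be any bivariate full moment sequence, i.e. any family of real numbers indexed by pairs of nonnegative integers. Then it has an interpolating measure; that is, there exists a (not necessarily positive) Borel measure $\tau$ on $\mathbb R^2$ such that $$\beta_{ij}=\int_{\mathbb R^2}x^i y^j\,d\tau(x,y)\qquad\text{for all integers } i,j\ge 0 .$$
   Context: An interpolating measure for a real double-index sequence $\{\beta_{ij}\}_{i,j\ge 0}$ is a signed (i.e. not necessarily positive) Borel measure $\tau$ on $\mathbb R^2$, with respect to which all the monomials $x^iy^j$ are integrable, such that $\beta_{ij}=\int x^iy^j\,d\tau$ for all $i,j\ge 0$. *)

theory Defs
  imports "HOL-Analysis.Analysis"
begin

text \<open>
  Only \<open>space M\<close> and \<open>sets M\<close> matter below. A signed measure is real-valued, hence finite; for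
  measures against which the constant function 1 is integrable this is no restriction.
\<close>

definition signed_measure :: "'a measure \<Rightarrow> ('a set \<Rightarrow> real) \<Rightarrow> bool" where
  "signed_measure M \<tau> \<longleftrightarrow>
     \<tau> {} = 0 \<and>
     (\<forall>A :: nat \<Rightarrow> 'a set. range A \<subseteq> sets M \<longrightarrow> disjoint_family A \<longrightarrow>
        (\<lambda>n. \<tau> (A n)) sums \<tau> (\<Union>n. A n))"

text \<open>
  The Jordan decomposition: the positive variation of \<open>A\<close> is the supremum of \<open>\<tau> B\<close> over measurable
  \<open>B \<subseteq> A\<close>. Since \<open>ennreal\<close> maps negative reals to 0 and \<open>B = {}\<close> is admitted, truncation
  does not change this supremum.
\<close>

definition positive_variation :: "'a measure \<Rightarrow> ('a set \<Rightarrow> real) \<Rightarrow> 'a measure" where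
  "positive_variation M \<tau> =
     measure_of (space M) (sets M) (\<lambda>A. SUP B\<in>{B \<in> sets M. B \<subseteq> A}. ennreal (\<tau> B))"

definition negative_variation :: "'a measure \<Rightarrow> ('a set \<Rightarrow> real) \<Rightarrow> 'a measure" where
  "negative_variation M \<tau> = positive_variation M (\<lambda>A. - \<tau> A)"

definition signed_integrable ::
    "'a measure \<Rightarrow> ('a set \<Rightarrow> real) \<Rightarrow> ('a \<Rightarrow> real) \<Rightarrow> bool" where
  "signed_integrable M \<tau> f \<longleftrightarrow>
     integrable (positive_variation M \<tau>) f \<and> integrable (negative_variation M \<tau>) f"

definition signed_integral ::
    "'a measure \<Rightarrow> ('a set \<Rightarrow> real) \<Rightarrow> ('a \<Rightarrow> real) \<Rightarrow> real" where
  "signed_integral M \<tau> f =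
     integral\<^sup>L (positive_variation M \<tau>) f - integral\<^sup>L (negative_variation M \<tau>) f"

definition interpolating_measure ::
    "(nat \<Rightarrow> nat \<Rightarrow> real) \<Rightarrow> ((real \<times> real) set \<Rightarrow> real) \<Rightarrow> bool" where
  "interpolating_measure \<beta> \<tau> \<longleftrightarrow>
     signed_measure borel \<tau> \<and>
     (\<forall>i j. signed_integrable borel \<tau> (\<lambda>(x, y). x ^ i * y ^ j) \<and>
            \<beta> i j = signed_integral borel \<tau> (\<lambda>(x, y). x ^ i * y ^ j))"

text \<open>
  \<open>measure_of\<close> silently yields the zero measure when its set function is not countably additive;
  the following facts show that this does not happen for signed measures.
\<close>

lemma signed_measure_Un:
  assumes "signed_measure M \<tau>" "B \<in> sets M" "C \<in> sets M" "B \<inter> C = {}"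
  shows "\<tau> (B \<union> C) = \<tau> B + \<tau> C"
proof -
  have "range (binaryset B C) \<subseteq> sets M"
    using assms(2,3) by (simp add: range_binaryset_eq)
  moreover have "disjoint_family (binaryset B C)"
    using assms(4) by (auto simp: disjoint_family_on_def binaryset_def)
  ultimately have "(\<lambda>n. \<tau> (binaryset B C n)) sums \<tau> (\<Union>n. binaryset B C n)"
    using assms(1) unfolding signed_measure_def by blast
  moreover have "(\<lambda>n. \<tau> (binaryset B C n)) sums (\<tau> B + \<tau> C)"
    using assms(1) by (intro binaryset_sums) (simp add: signed_measure_def)
  ultimately show ?thesis
    by (simp add: UN_binaryset_eq sums_unique2)
qed

lemma signed_measure_uminus:
  assumes "signed_measure M \<tau>"
  shows "signed_measure M (\<lambda>A. - \<tau> A)"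
  using assms by (simp add: signed_measure_def sums_minus)

lemma sets_positive_variation [simp]: "sets (positive_variation M \<tau>) = sets M"
  and space_positive_variation [simp]: "space (positive_variation M \<tau>) = space M"
  by (simp_all add: positive_variation_def)

lemma emeasure_positive_variation:
  assumes \<tau>: "signed_measure M \<tau>" and "A \<in> sets M"
  shows "emeasure (positive_variation M \<tau>) A = (SUP B\<in>{B \<in> sets M. B \<subseteq> A}. ennreal (\<tau> B))"
proof -
  define f where "f = (\<lambda>A. SUP B\<in>{B \<in> sets M. B \<subseteq> A}. ennreal (\<tau> B))"
  have f_ge: "ennreal (\<tau> B) \<le> f A" if "B \<in> sets M" "B \<subseteq> A" for A B
    using that unfolding f_def by (intro SUP_upper) auto
  have f_mono: "f A \<le> f B" if "A \<subseteq> B" for A B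
    using that unfolding f_def by (intro SUP_subset_mono) auto
  have f0: "f {} = 0"
  proof -
    have "{B \<in> sets M. B \<subseteq> {}} = {{}}" by auto
    then show ?thesis using \<tau> by (simp add: f_def signed_measure_def)
  qed
  have f_Un: "f A + f B \<le> f (A \<union> B)" if AB: "A \<inter> B = {}" for A B
  proof -
    have *: "ennreal (\<tau> C) + ennreal (\<tau> D) \<le> f (A \<union> B)"
      if "C \<in> sets M" "C \<subseteq> A" "D \<in> sets M" "D \<subseteq> B" for C D
    proof (cases "\<tau> C \<ge> 0 \<and> \<tau> D \<ge> 0")
      case True
      have "\<tau> (C \<union> D) = \<tau> C + \<tau> D"
        using that AB by (intro signed_measure_Un[OF \<tau>]) auto
      with True have "ennreal (\<tau> C) + ennreal (\<tau> D) = ennreal (\<tau> (C \<union> D))"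
        by simp
      also have "\<dots> \<le> f (A \<union> B)" using that by (intro f_ge) auto
      finally show ?thesis .
    next
      case False
      then consider "\<tau> C \<le> 0" | "\<tau> D \<le> 0" by linarith
      then show ?thesis
      proof cases
        case 1
        then show ?thesis using f_ge[of D "A \<union> B"] that by (auto simp: ennreal_neg)
      next
        case 2
        then show ?thesis using f_ge[of C "A \<union> B"] that by (auto simp: ennreal_neg)
      qed
    qed
    have ne: "{B \<in> sets M. B \<subseteq> X} \<noteq> {}" for X by auto
    have "f A + f B = (SUP C\<in>{C \<in> sets M. C \<subseteq> A}. ennreal (\<tau> C) + f B)"
      unfolding f_def by (rule ennreal_SUP_add_left[OF ne, symmetric])
    also have "\<dots> \<le> f (A \<union> B)"
    proof (rule SUP_least)
      fix C assume C: "C \<in> {C \<in> sets M. C \<subseteq> A}"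
      have "ennreal (\<tau> C) + f B = (SUP D\<in>{D \<in> sets M. D \<subseteq> B}. ennreal (\<tau> C) + ennreal (\<tau> D))"
        unfolding f_def by (rule ennreal_SUP_add_right[OF ne])
      also have "\<dots> \<le> f (A \<union> B)" using C * by (intro SUP_least) auto
      finally show "ennreal (\<tau> C) + f B \<le> f (A \<union> B)" .
    qed
    finally show ?thesis .
  qed
  have ca: "countably_additive (sets M) f"
    unfolding countably_additive_def
  proof (intro allI impI, rule order.antisym)
    fix A :: "nat \<Rightarrow> 'a set"
    assume A: "range A \<subseteq> sets M" "disjoint_family A" "(\<Union>i. A i) \<in> sets M"
    have "(\<Sum>i<n. f (A i)) \<le> f (\<Union>i<n. A i)" for n
    proof (induction n)
      case (Suc n)
      have "A i \<inter> A n = {}" if "i < n" for i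
        using A(2) that by (intro disjoint_family_onD[OF A(2)]) auto
      then have "(\<Union>i<n. A i) \<inter> A n = {}"
        by blast
      then have "f (\<Union>i<n. A i) + f (A n) \<le> f ((\<Union>i<n. A i) \<union> A n)"
        by (rule f_Un)
      moreover have "(\<Union>i<n. A i) \<union> A n = (\<Union>i<Suc n. A i)"
        by (auto simp: lessThan_Suc)
      ultimately have "f (\<Union>i<n. A i) + f (A n) \<le> f (\<Union>i<Suc n. A i)"
        by metis
      then have "(\<Sum>i<n. f (A i)) + f (A n) \<le> f (\<Union>i<Suc n. A i)"
        using add_right_mono[OF Suc.IH, of "f (A n)"] by (rule order_trans[rotated])
      then show ?case
        by (simp only: sum.lessThan_Suc)
    qed (simp add: f0)
    moreover have "f (\<Union>i<n. A i) \<le> f (\<Union>i. A i)" for n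
      by (intro f_mono) auto
    ultimately have "(\<Sum>i<n. f (A i)) \<le> f (\<Union>i. A i)" for n
      by (rule order_trans)
    then show "(\<Sum>i. f (A i)) \<le> f (\<Union>i. A i)"
      by (intro suminf_le_const) auto
    have "ennreal (\<tau> B) \<le> (\<Sum>i. f (A i))" if B: "B \<in> sets M" "B \<subseteq> (\<Union>i. A i)" for B
    proof -
      have "(\<lambda>n. \<tau> (B \<inter> A n)) sums \<tau> (\<Union>n. B \<inter> A n)"
      proof -
        have "range (\<lambda>n. B \<inter> A n) \<subseteq> sets M" using A B by auto
        moreover have "disjoint_family (\<lambda>n. B \<inter> A n)"
          using A(2) by (auto simp: disjoint_family_on_def)
        ultimately show ?thesis using \<tau> unfolding signed_measure_def by blast
      qed
      moreover have "(\<Union>n. B \<inter> A n) = B" using B by auto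
      ultimately have "(\<lambda>n. \<Sum>i<n. \<tau> (B \<inter> A i)) \<longlonglongrightarrow> \<tau> B"
        by (simp add: sums_def)
      then have lim: "(\<lambda>n. ennreal (\<Sum>i<n. \<tau> (B \<inter> A i))) \<longlonglongrightarrow> ennreal (\<tau> B)"
        by (rule tendsto_ennrealI)
      have "ennreal (\<Sum>i<n. \<tau> (B \<inter> A i)) \<le> (\<Sum>i. f (A i))" for n
      proof -
        have "ennreal (\<Sum>i<n. \<tau> (B \<inter> A i)) \<le> ennreal (\<Sum>i<n. max 0 (\<tau> (B \<inter> A i)))"
          by (intro ennreal_leI sum_mono) auto
        also have "\<dots> = (\<Sum>i<n. ennreal (max 0 (\<tau> (B \<inter> A i))))"
          by simp
        also have "\<dots> = (\<Sum>i<n. ennreal (\<tau> (B \<inter> A i)))"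
          by (intro sum.cong) (auto simp: max_def ennreal_neg)
        also have "\<dots> \<le> (\<Sum>i<n. f (A i))"
          using A B by (intro sum_mono f_ge) auto
        also have "\<dots> \<le> (\<Sum>i. f (A i))"
          by (intro sum_le_suminf) auto
        finally show ?thesis .
      qed
      then show ?thesis by (intro LIMSEQ_le_const2[OF lim]) auto
    qed
    then show "f (\<Union>i. A i) \<le> (\<Sum>i. f (A i))"
      unfolding f_def by (intro SUP_least) auto
  qed
  show ?thesis
    unfolding positive_variation_def
    using emeasure_measure_of_sigma[OF sets.sigma_algebra_axioms _ ca \<open>A \<in> sets M\<close>] f0
    by (simp add: f_def positive_def)
qed

end

theory Submission
  imports Defs "HOL-Computational_Algebra.Polynomial"
begin

text \<open>
  The measure is purely atomic: an infinite sum of blocks \<open>w 0, w 1, \<dots>\<close>, each consisting of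
  finitely many signed point masses, where block \<open>m\<close> is responsible for the \<open>m\<close>-th monomial. The
  monomials are ordered by total degree, as the pairing function \<open>prod_encode\<close> does. Two properties
  of the blocks make this work.

  First, the system is triangular. The block for \<open>x\<^sup>i y\<^sup>j\<close> has all moments \<open>(a, b)\<close> with
  \<open>a < i\<close> or \<open>b < j\<close> equal to zero, so later blocks do not disturb moments that are already correct,
  and its moment \<open>(i, j)\<close> can be chosen freely so as to correct what the earlier blocks produce.
  Such blocks come from a one-dimensional observation: masses \<open>coeff P k\<close> at the points \<open>2\<^sup>k\<close> have
  \<open>a\<close>-th moment \<open>poly P (2\<^sup>a)\<close>, which vanishes for \<open>a < i\<close> and not for \<open>a = i\<close> if \<open>P\<close> is the
  polynomial with roots \<open>2\<^sup>0, \<dots>, 2\<^sup>i\<^sup>-\<^sup>1\<close>. In the plane one takes products.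

  Secondly, the sum converges. Dilating the block by a factor \<open>t\<close> multiplies moments of degree \<open>e\<close> by
  \<open>t\<^sup>e\<close>; after renormalising the leading moment of degree \<open>d = i + j\<close>, absolute moments of degree
  \<open>e < d\<close> carry the factor \<open>t\<^sup>e\<^sup>-\<^sup>d\<close> and are as small as desired when \<open>t\<close> is large
  (\<open>atoms_with_leading_moment\<close>). Only finitely many blocks have degree at most a given number, so
  every fixed absolute moment is summable over the blocks (\<open>ex_atom_blocks\<close>), and integrals may be
  exchanged with the sum (\<open>ex_density_with_moments\<close>).

  The sum is encoded as a density \<open>u\<close> with respect to the counting measure, and the signed measure is
  the indefinite integral of \<open>u\<close>. Its positive and negative variation then have the densities
  \<open>max 0 u\<close> and \<open>max 0 (- u)\<close>, so integrals against the signed measure reduce to integrals of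
  \<open>u x * f x\<close> (\<open>signed_integral_density\<close>).
\<close>

section \<open>Signed measures given by densities\<close>

lemma signed_measure_density:
  fixes u :: "'a \<Rightarrow> real"
  assumes u: "integrable M u"
  shows "signed_measure M (\<lambda>A. LINT x:A|M. u x)"
  unfolding signed_measure_def
proof (intro conjI allI impI)
  show "(LINT x:{}|M. u x) = 0"
    by (simp add: set_lebesgue_integral_def)
next
  fix A :: "nat \<Rightarrow> 'a set"
  assume A: "range A \<subseteq> sets M" and disj: "disjoint_family A"
  have meas [measurable]: "A i \<in> sets M" for i
    using A by auto
  have int: "set_integrable M B u" if "B \<in> sets M" for B
    using integrable_mult_indicator[OF that u] by (simp add: set_integrable_def)
  have "(\<lambda>n. LINT x:(\<Union>i<n. A i)|M. u x) \<longlonglongrightarrow> (LINT x:(\<Union>n. \<Union>i<n. A i)|M. u x)"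
  proof (rule set_integral_cont_up)
    show "incseq (\<lambda>n. \<Union>i<n. A i)"
      by (intro incseq_SucI) (auto simp: lessThan_Suc)
    show "set_integrable M (\<Union>n. \<Union>i<n. A i) u"
      by (intro int) measurable
  qed measurable
  moreover have "(\<Union>n. \<Union>i<n. A i) = (\<Union>n. A n)"
    by blast
  moreover have "(LINT x:(\<Union>i<n. A i)|M. u x) = (\<Sum>i<n. LINT x:A i|M. u x)" for n
    using disj by (intro set_integral_finite_Union int) (auto simp: disjoint_family_on_def)
  ultimately show "(\<lambda>n. LINT x:A n|M. u x) sums (LINT x:(\<Union>n. A n)|M. u x)"
    by (simp add: sums_def)
qed

text \<open>
  Among the measurable subsets of \<open>A\<close>, the set where \<open>u\<close> is positive has the largest integral, so
  the supremum that defines the positive variation is attained there.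
\<close>

lemma positive_variation_density:
  fixes u :: "'a \<Rightarrow> real"
  assumes u: "integrable M u"
  shows "positive_variation M (\<lambda>A. LINT x:A|M. u x) = density M (\<lambda>x. ennreal (u x))"
    (is "?P = ?D")
proof (rule measure_eqI)
  show "sets ?P = sets ?D"
    by simp
next
  fix A assume "A \<in> sets ?P"
  then have A [measurable]: "A \<in> sets M"
    by simp
  have [measurable]: "u \<in> borel_measurable M"
    using u by auto
  have nonneg: "ennreal (LINT x:B|M. u x) = (\<integral>\<^sup>+x\<in>B. ennreal (u x) \<partial>M)"
    if [measurable]: "B \<in> sets M" and "\<And>x. x \<in> B \<Longrightarrow> 0 \<le> u x" for B
  proof -
    have "ennreal (LINT x:B|M. u x) = (\<integral>\<^sup>+x. ennreal (indicator B x * u x) \<partial>M)"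
      unfolding set_lebesgue_integral_def using that integrable_mult_indicator[OF that(1) u]
      by (subst nn_integral_eq_integral) (auto split: split_indicator)
    also have "\<dots> = (\<integral>\<^sup>+x\<in>B. ennreal (u x) \<partial>M)"
      by (intro nn_integral_cong) (auto split: split_indicator)
    finally show ?thesis .
  qed
  let ?H = "A \<inter> {x \<in> space M. 0 < u x}"
  have H [measurable]: "?H \<in> sets M"
    by measurable
  have D: "emeasure ?D A = ennreal (LINT x:?H|M. u x)"
  proof -
    have "emeasure ?D A = (\<integral>\<^sup>+x\<in>A. ennreal (u x) \<partial>M)"
      by (simp add: emeasure_density)
    also have "\<dots> = (\<integral>\<^sup>+x\<in>?H. ennreal (u x) \<partial>M)"
      by (intro nn_integral_cong) (auto split: split_indicator simp: ennreal_neg not_less)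
    also have "\<dots> = ennreal (LINT x:?H|M. u x)"
      by (rule nonneg[symmetric]) auto
    finally show ?thesis .
  qed
  have "(SUP B\<in>{B \<in> sets M. B \<subseteq> A}. ennreal (LINT x:B|M. u x)) = ennreal (LINT x:?H|M. u x)"
  proof (rule antisym)
    show "(SUP B\<in>{B \<in> sets M. B \<subseteq> A}. ennreal (LINT x:B|M. u x)) \<le> ennreal (LINT x:?H|M. u x)"
    proof (rule SUP_least, rule ennreal_leI)
      fix B assume "B \<in> {B \<in> sets M. B \<subseteq> A}"
      then have B: "B \<in> sets M" "B \<subseteq> A"
        by auto
      show "(LINT x:B|M. u x) \<le> (LINT x:?H|M. u x)"
        unfolding set_lebesgue_integral_def
        using integrable_mult_indicator[OF B(1) u] integrable_mult_indicator[OF H u] B(2)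
        by (intro integral_mono) (auto split: split_indicator)
    qed
    show "ennreal (LINT x:?H|M. u x) \<le> (SUP B\<in>{B \<in> sets M. B \<subseteq> A}. ennreal (LINT x:B|M. u x))"
      using H by (intro SUP_upper) auto
  qed
  then show "emeasure ?P A = emeasure ?D A"
    using D emeasure_positive_variation[OF signed_measure_density[OF u] A] by simp
qed

lemma negative_variation_density:
  fixes u :: "'a \<Rightarrow> real"
  assumes u: "integrable M u"
  shows "negative_variation M (\<lambda>A. LINT x:A|M. u x) = density M (\<lambda>x. ennreal (- u x))"
  using positive_variation_density[of M "\<lambda>x. - u x"] u
  by (simp add: negative_variation_def set_lebesgue_integral_def)

lemma signed_integral_density:
  fixes u f :: "'a \<Rightarrow> real"
  assumes u: "integrable M u" and f [measurable]: "f \<in> borel_measurable M"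
    and uf: "integrable M (\<lambda>x. u x * f x)"
  shows "signed_integrable M (\<lambda>A. LINT x:A|M. u x) f"
    and "signed_integral M (\<lambda>A. LINT x:A|M. u x) f = (\<integral>x. u x * f x \<partial>M)"
proof -
  have [measurable]: "u \<in> borel_measurable M"
    using u by auto
  have pos: "positive_variation M (\<lambda>A. LINT x:A|M. u x) = density M (\<lambda>x. ennreal (max 0 (u x)))"
    unfolding positive_variation_density[OF u]
    by (intro arg_cong[where f = "density M"]) (auto simp: max_def ennreal_neg)
  have neg: "negative_variation M (\<lambda>A. LINT x:A|M. u x) = density M (\<lambda>x. ennreal (max 0 (- u x)))"
    unfolding negative_variation_density[OF u]
    by (intro arg_cong[where f = "density M"]) (auto simp: max_def ennreal_neg)
  have int_pos: "integrable M (\<lambda>x. max 0 (u x) * f x)"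
    and int_neg: "integrable M (\<lambda>x. max 0 (- u x) * f x)"
    by (rule Bochner_Integration.integrable_bound[OF uf]; auto simp: abs_mult intro!: AE_I2 mult_right_mono)+
  show "signed_integrable M (\<lambda>A. LINT x:A|M. u x) f"
    unfolding signed_integrable_def pos neg
    using int_pos int_neg by (simp add: integrable_real_density)
  have "signed_integral M (\<lambda>A. LINT x:A|M. u x) f =
      (\<integral>x. max 0 (u x) * f x \<partial>M) - (\<integral>x. max 0 (- u x) * f x \<partial>M)"
    unfolding signed_integral_def pos neg by (simp add: integral_real_density)
  also have "\<dots> = (\<integral>x. max 0 (u x) * f x - max 0 (- u x) * f x \<partial>M)"
    using int_pos int_neg by simp
  also have "\<dots> = (\<integral>x. u x * f x \<partial>M)"
    by (intro Bochner_Integration.integral_cong) (auto simp: max_def)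
  finally show "signed_integral M (\<lambda>A. LINT x:A|M. u x) f = (\<integral>x. u x * f x \<partial>M)" .
qed

section \<open>Finitely many atoms with prescribed leading moments\<close>

text \<open>
  Counting measure is pushed to the Borel sets because the variations of a signed measure live on the
  same sigma algebra as the measure itself. As a density for it, a function is its own point masses.
\<close>

definition borel_counting :: "'a::t1_space measure" where
  "borel_counting = distr (count_space UNIV) borel (\<lambda>x. x)"

lemma sets_borel_counting [simp, measurable_cong]: "sets borel_counting = sets borel"
  and space_borel_counting [simp]: "space borel_counting = UNIV"
  by (simp_all add: borel_counting_def)

lemma emeasure_borel_counting_singleton [simp]: "emeasure borel_counting {x} = 1"
  by (simp add: borel_counting_def emeasure_distr)

lemma has_integral_atom:
  fixes f :: "'a::t1_space \<Rightarrow> real"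
  shows "has_bochner_integral borel_counting (\<lambda>x. c * indicator {z} x * f x) (c * f z)"
proof -
  have "has_bochner_integral borel_counting (indicator {z} :: 'a \<Rightarrow> real) 1"
    using has_bochner_integral_real_indicator[of "{z}" borel_counting]
    by (simp add: measure_def)
  then have "has_bochner_integral borel_counting (\<lambda>x. (c * f z) * indicator {z} x) (c * f z * 1)"
    by (rule has_bochner_integral_mult_right)
  moreover have "(\<lambda>x. (c * f z) * indicator {z} x) = (\<lambda>x. c * indicator {z} x * f x)"
    by (auto simp: fun_eq_iff split: split_indicator)
  ultimately show ?thesis
    by simp
qed

text \<open>
  The points \<open>z q\<close> may coincide, and masses may then cancel. This is why the absolute moment is only
  bounded by, and not equal to, the sum of the absolute contributions.
\<close>

lemma integral_finitely_many_atoms: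
  fixes f :: "'a::t1_space \<Rightarrow> real"
  assumes "finite F" and w: "\<And>x. w x = (\<Sum>q\<in>F. c q * indicator {z q} x)"
  shows "integrable borel_counting (\<lambda>x. w x * f x)"
    and "(\<integral>x. w x * f x \<partial>borel_counting) = (\<Sum>q\<in>F. c q * f (z q))"
    and "(\<integral>x. \<bar>w x * f x\<bar> \<partial>borel_counting) \<le> (\<Sum>q\<in>F. \<bar>c q * f (z q)\<bar>)"
proof -
  have eq: "(\<lambda>x. w x * f x) = (\<lambda>x. \<Sum>q\<in>F. c q * indicator {z q} x * f x)"
    by (simp add: w sum_distrib_right)
  have hb: "has_bochner_integral borel_counting (\<lambda>x. w x * f x) (\<Sum>q\<in>F. c q * f (z q))"
    unfolding eq by (intro has_bochner_integral_sum has_integral_atom)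
  then show int: "integrable borel_counting (\<lambda>x. w x * f x)"
    and "(\<integral>x. w x * f x \<partial>borel_counting) = (\<Sum>q\<in>F. c q * f (z q))"
    by (auto simp: has_bochner_integral_iff)
  have hb_abs: "has_bochner_integral borel_counting
      (\<lambda>x. \<Sum>q\<in>F. \<bar>c q\<bar> * indicator {z q} x * \<bar>f x\<bar>) (\<Sum>q\<in>F. \<bar>c q\<bar> * \<bar>f (z q)\<bar>)"
    by (intro has_bochner_integral_sum has_integral_atom)
  have "(\<integral>x. \<bar>w x * f x\<bar> \<partial>borel_counting) \<le>
      (\<integral>x. (\<Sum>q\<in>F. \<bar>c q\<bar> * indicator {z q} x * \<bar>f x\<bar>) \<partial>borel_counting)"
  proof (rule integral_mono)
    show "\<bar>w x * f x\<bar> \<le> (\<Sum>q\<in>F. \<bar>c q\<bar> * indicator {z q} x * \<bar>f x\<bar>)" for x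
      unfolding fun_cong[OF eq]
      by (rule order_trans[OF sum_abs]) (simp add: abs_mult)
  qed (use int hb_abs in \<open>auto simp: has_bochner_integral_iff\<close>)
  also have "\<dots> = (\<Sum>q\<in>F. \<bar>c q * f (z q)\<bar>)"
    using hb_abs by (simp add: has_bochner_integral_iff abs_mult)
  finally show "(\<integral>x. \<bar>w x * f x\<bar> \<partial>borel_counting) \<le> (\<Sum>q\<in>F. \<bar>c q * f (z q)\<bar>)" .
qed

definition monomial :: "nat \<Rightarrow> nat \<Rightarrow> real \<times> real \<Rightarrow> real" where
  "monomial a b = (\<lambda>(x, y). x ^ a * y ^ b)"

lemma measurable_monomial [measurable]: "monomial a b \<in> borel_measurable borel"
  unfolding monomial_def by (intro borel_measurable_continuous_onI) (simp add: case_prod_unfold continuous_intros)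

text \<open>
  The coefficients of this polynomial, as masses at the powers of 2, annihilate all \<open>x\<^sup>a\<close> with
  \<open>a < i\<close>, since the \<open>a\<close>-th moment of the masses is the value of the polynomial at \<open>2\<^sup>a\<close>.
\<close>

definition geometric_annihilator :: "nat \<Rightarrow> real poly" where
  "geometric_annihilator i = (\<Prod>k<i. [:- (2 ^ k), 1:])"

lemma poly_geometric_annihilator_eq_0:
  "a < i \<Longrightarrow> poly (geometric_annihilator i) (2 ^ a) = 0"
  by (auto simp: geometric_annihilator_def poly_prod)

lemma poly_geometric_annihilator_neq_0: "poly (geometric_annihilator i) (2 ^ i) \<noteq> 0"
  by (auto simp: geometric_annihilator_def poly_prod)

text \<open>
  Masses proportional to \<open>coeff P k * coeff Q l\<close> at the points \<open>(t * 2\<^sup>k, t * 2\<^sup>l)\<close>, with \<open>P\<close> and \<open>Q\<close>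
  the annihilators for \<open>i\<close> and \<open>j\<close>, have moment \<open>(a, b)\<close> proportional to
  \<open>t\<^sup>a\<^sup>+\<^sup>b * poly P (2\<^sup>a) * poly Q (2\<^sup>b)\<close>. Normalising the leading moment divides by \<open>t\<^sup>i\<^sup>+\<^sup>j\<close>, which
  leaves at least one factor \<open>1 / t\<close> in all moments of lower degree.
\<close>

lemma atoms_with_leading_moment:
  fixes s \<epsilon> :: real
  assumes "\<epsilon> > 0"
  shows "\<exists>w :: real \<times> real \<Rightarrow> real.
    (\<forall>a b. integrable borel_counting (\<lambda>z. w z * monomial a b z)) \<and>
    (\<integral>z. w z * monomial i j z \<partial>borel_counting) = s \<and>
    (\<forall>a b. a < i \<or> b < j \<longrightarrow> (\<integral>z. w z * monomial a b z \<partial>borel_counting) = 0) \<and>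
    (\<forall>a b. a + b < i + j \<longrightarrow> (\<integral>z. \<bar>w z * monomial a b z\<bar> \<partial>borel_counting) \<le> \<epsilon>)"
proof -
  define P where "P = geometric_annihilator i"
  define Q where "Q = geometric_annihilator j"
  define F where "F = {..degree P} \<times> {..degree Q}"
  define r where "r = s / (poly P (2 ^ i) * poly Q (2 ^ j))"
  \<comment> \<open>\<open>C / t\<close> bounds all absolute moments of degree below \<open>i + j\<close>; \<open>t\<close> is chosen to make this at
    most \<open>\<epsilon>\<close>, and at least 1 so that its powers increase.\<close>
  define C where "C = (\<Sum>(k, l)\<in>F. \<bar>r * coeff P k * coeff Q l\<bar> * (2 ^ (k + l)) ^ (i + j))"
  define t where "t = 1 + C / \<epsilon>"
  define c where "c = (\<lambda>(k, l). r / t ^ (i + j) * coeff P k * coeff Q l)"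
  define z :: "nat \<times> nat \<Rightarrow> real \<times> real" where "z = (\<lambda>(k, l). (t * 2 ^ k, t * 2 ^ l))"
  define w where "w = (\<lambda>x. \<Sum>q\<in>F. c q * indicator {z q} x)"
  have "finite F"
    by (simp add: F_def)
  have "w x = (\<Sum>q\<in>F. c q * indicator {z q} x)" for x
    by (simp add: w_def)
  note atoms = integral_finitely_many_atoms[OF \<open>finite F\<close> this]
  have "C \<ge> 0"
    unfolding C_def by (intro sum_nonneg) (auto simp: case_prod_unfold)
  then have t: "t \<ge> 1" "C / t \<le> \<epsilon>"
    using assms by (auto simp: t_def field_simps intro: add_pos_nonneg)
  have term_eq: "c (k, l) * monomial a b (z (k, l)) =
      r * t ^ (a + b) / t ^ (i + j) * ((coeff P k * (2 ^ a) ^ k) * (coeff Q l * (2 ^ b) ^ l))" for k l a b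
  proof -
    have "((2::real) ^ k) ^ a = (2 ^ a) ^ k" "((2::real) ^ l) ^ b = (2 ^ b) ^ l"
      by (simp_all only: power_mult [symmetric] mult.commute)
    then show ?thesis
      by (simp add: c_def z_def monomial_def power_mult_distrib power_add)
  qed
  have moment: "(\<integral>x. w x * monomial a b x \<partial>borel_counting) =
      r * t ^ (a + b) / t ^ (i + j) * (poly P (2 ^ a) * poly Q (2 ^ b))" for a b
  proof -
    have "(\<integral>x. w x * monomial a b x \<partial>borel_counting) = (\<Sum>(k, l)\<in>F.
        r * t ^ (a + b) / t ^ (i + j) * ((coeff P k * (2 ^ a) ^ k) * (coeff Q l * (2 ^ b) ^ l)))"
      unfolding atoms(2) by (rule sum.cong[OF refl]) (clarsimp simp only: term_eq split: prod.split)
    also have "\<dots> = r * t ^ (a + b) / t ^ (i + j) * (\<Sum>k\<le>degree P. \<Sum>l\<le>degree Q.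
        (coeff P k * (2 ^ a) ^ k) * (coeff Q l * (2 ^ b) ^ l))"
      by (simp only: F_def sum.cartesian_product sum_distrib_left case_prod_unfold)
    finally show ?thesis
      by (simp only: poly_altdef sum_product)
  qed
  show ?thesis
  proof (intro exI[of _ w] conjI allI impI)
    show "integrable borel_counting (\<lambda>x. w x * monomial a b x)" for a b
      by (rule atoms(1))
    show "(\<integral>x. w x * monomial i j x \<partial>borel_counting) = s"
      using t(1) by (simp add: moment r_def P_def Q_def poly_geometric_annihilator_neq_0)
    show "(\<integral>x. w x * monomial a b x \<partial>borel_counting) = 0" if "a < i \<or> b < j" for a b
    proof -
      have "poly P (2 ^ a) = 0 \<or> poly Q (2 ^ b) = 0"
        using that unfolding P_def Q_def by (blast intro: poly_geometric_annihilator_eq_0)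
      then show ?thesis
        unfolding moment by (metis mult_zero_left mult_zero_right)
    qed
    show "(\<integral>x. \<bar>w x * monomial a b x\<bar> \<partial>borel_counting) \<le> \<epsilon>" if ab: "a + b < i + j" for a b
    proof -
      have t_le: "t ^ (a + b) / t ^ (i + j) \<le> 1 / t"
      proof -
        have "t ^ Suc (a + b) \<le> t ^ (i + j)"
          using t(1) ab by (intro power_increasing) auto
        then show ?thesis
          using t(1) by (simp add: field_simps)
      qed
      have "\<bar>c q * monomial a b (z q)\<bar> \<le>
          (case q of (k, l) \<Rightarrow> \<bar>r * coeff P k * coeff Q l\<bar> * (2 ^ (k + l)) ^ (i + j)) * (1 / t)" for q
      proof (cases q)
        case (Pair k l)
        have "((2::real) ^ a) ^ k * (2 ^ b) ^ l = 2 ^ (a * k + b * l)"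
          by (simp add: power_add power_mult)
        also have "\<dots> \<le> 2 ^ ((k + l) * (i + j))"
        proof (rule power_increasing)
          have "a * k + b * l \<le> (i + j) * k + (i + j) * l"
            using ab by (intro add_mono mult_right_mono) auto
          then show "a * k + b * l \<le> (k + l) * (i + j)"
            by (simp add: algebra_simps)
        qed simp
        finally have pow_le: "((2::real) ^ a) ^ k * (2 ^ b) ^ l \<le> (2 ^ (k + l)) ^ (i + j)"
          by (simp add: power_mult)
        have "\<bar>c q * monomial a b (z q)\<bar> = \<bar>r * coeff P k * coeff Q l\<bar> *
            ((t ^ (a + b) / t ^ (i + j)) * ((2 ^ a) ^ k * (2 ^ b) ^ l))"
          using t(1) by (simp add: Pair term_eq abs_mult)
        also have "\<dots> \<le> \<bar>r * coeff P k * coeff Q l\<bar> * ((1 / t) * (2 ^ (k + l)) ^ (i + j))"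
          using t(1) by (intro mult_left_mono mult_mono t_le pow_le) auto
        finally show ?thesis
          by (simp add: Pair)
      qed
      then have "(\<Sum>q\<in>F. \<bar>c q * monomial a b (z q)\<bar>) \<le> C * (1 / t)"
        unfolding C_def sum_distrib_right by (intro sum_mono)
      then show ?thesis
        using atoms(3)[of "monomial a b"] t(2) by simp
    qed
  qed
qed

section \<open>Summing blocks of atoms\<close>

lemma prod_encode_mono:
  assumes "a \<le> c" "b \<le> d"
  shows "prod_encode (a, b) \<le> prod_encode (c, d)"
proof -
  have "mono triangle"
    by (rule mono_iff_le_Suc[THEN iffD2]) simp
  then have "triangle (a + b) \<le> triangle (c + d)"
    by (rule monoD) (intro add_mono assms)
  then show ?thesis
    using assms by (simp add: prod_encode_def)
qed

text \<open>
  Only finitely many monomials have degree at most \<open>n\<close>.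
\<close>

lemma eventually_degree_greater:
  "eventually (\<lambda>m. n < fst (prod_decode m) + snd (prod_decode m)) sequentially"
proof -
  have "{m. \<not> n < fst (prod_decode m) + snd (prod_decode m)} \<subseteq> prod_encode ` ({..n} \<times> {..n})"
  proof
    fix m assume "m \<in> {m. \<not> n < fst (prod_decode m) + snd (prod_decode m)}"
    then have "prod_decode m \<in> {..n} \<times> {..n}"
      by (auto simp: mem_Times_iff)
    then show "m \<in> prod_encode ` ({..n} \<times> {..n})"
      by (metis image_eqI prod_decode_inverse)
  qed
  then have "finite {m. \<not> n < fst (prod_decode m) + snd (prod_decode m)}"
    by (rule finite_subset) simp
  then show ?thesis
    by (simp add: eventually_cofinite flip: cofinite_eq_sequentially)
qed

text \<open>
  The blocks are chosen recursively. The moments of the earlier blocks determine the leading moment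
  that block \<open>m\<close> must have, and its lower absolute moments are made smaller than \<open>(1 / 2) ^ m\<close>, so
  that from some point on every fixed moment is dominated by a geometric series.
\<close>

lemma ex_atom_blocks:
  fixes \<beta> :: "nat \<Rightarrow> nat \<Rightarrow> real"
  shows "\<exists>w :: nat \<Rightarrow> real \<times> real \<Rightarrow> real.
    (\<forall>m a b. integrable borel_counting (\<lambda>z. w m z * monomial a b z)) \<and>
    (\<forall>a b. summable (\<lambda>m. \<integral>z. \<bar>w m z * monomial a b z\<bar> \<partial>borel_counting)) \<and>
    (\<forall>a b. (\<Sum>m. \<integral>z. w m z * monomial a b z \<partial>borel_counting) = \<beta> a b)"
proof -
  define I where "I = (\<lambda>(w :: real \<times> real \<Rightarrow> real) (a, b). \<integral>z. w z * monomial a b z \<partial>borel_counting)"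
  define good where "good = (\<lambda>f m w.
      (\<forall>a b. integrable borel_counting (\<lambda>z. w z * monomial a b z)) \<and>
      I w (prod_decode m) = case_prod \<beta> (prod_decode m) - (\<Sum>l<m. I (f l) (prod_decode m)) \<and>
      (\<forall>a b. a < fst (prod_decode m) \<or> b < snd (prod_decode m) \<longrightarrow> I w (a, b) = 0) \<and>
      (\<forall>a b. a + b < fst (prod_decode m) + snd (prod_decode m) \<longrightarrow>
         (\<integral>z. \<bar>w z * monomial a b z\<bar> \<partial>borel_counting) \<le> (1 / 2) ^ m))"
  have "\<exists>w. \<forall>m. good w m (w m)"
  proof (rule dependent_wellorder_choice)
    fix w and f g :: "nat \<Rightarrow> real \<times> real \<Rightarrow> real" and m
    assume "\<And>l. l < m \<Longrightarrow> f l = g l"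
    then have "(\<Sum>l<m. I (f l) (prod_decode m)) = (\<Sum>l<m. I (g l) (prod_decode m))"
      by (intro sum.cong) auto
    then show "good f m w = good g m w"
      by (simp add: good_def)
  next
    fix m f
    show "\<exists>w. good f m w"
    proof (cases "prod_decode m")
      case (Pair i j)
      show ?thesis
        unfolding good_def Pair I_def prod.case fst_conv snd_conv
        by (rule atoms_with_leading_moment) simp
    qed
  qed
  then obtain w where w: "good w m (w m)" for m
    by blast
  show ?thesis
  proof (intro exI[of _ w] conjI allI)
    show "integrable borel_counting (\<lambda>z. w m z * monomial a b z)" for m a b
      using w[of m] by (simp add: good_def)
    show "summable (\<lambda>m. \<integral>z. \<bar>w m z * monomial a b z\<bar> \<partial>borel_counting)" for a b
    proof (rule summable_comparison_test_ev)
      show "\<forall>\<^sub>F m in sequentially.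
          norm (\<integral>z. \<bar>w m z * monomial a b z\<bar> \<partial>borel_counting) \<le> (1 / 2) ^ m"
        using eventually_degree_greater[of "a + b"]
      proof eventually_elim
        case (elim m)
        then show ?case
          using w[of m] by (simp add: good_def)
      qed
    qed (simp add: summable_geometric)
    show "(\<Sum>m. \<integral>z. w m z * monomial a b z \<partial>borel_counting) = \<beta> a b" for a b
    proof -
      define n where "n = prod_encode (a, b)"
      \<comment> \<open>A block past the position \<open>n\<close> of \<open>(a, b)\<close> cannot have an index below \<open>(a, b)\<close> in both
        components, so it annihilates this monomial.\<close>
      have later: "I (w m) (a, b) = 0" if "m \<notin> {..n}" for m
      proof -
        have "a < fst (prod_decode m) \<or> b < snd (prod_decode m)"
        proof (rule ccontr)
          assume "\<not> ?thesis"
          then have "prod_encode (fst (prod_decode m), snd (prod_decode m)) \<le> n"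
            unfolding n_def by (intro prod_encode_mono) auto
          then show False
            using that by simp
        qed
        then show ?thesis
          using w[of m] unfolding good_def by blast
      qed
      have "(\<Sum>m. I (w m) (a, b)) = (\<Sum>m\<le>n. I (w m) (a, b))"
        by (rule suminf_finite) (use later in auto)
      also have "\<dots> = (\<Sum>m<n. I (w m) (a, b)) + I (w n) (a, b)"
        by (simp flip: lessThan_Suc_atMost)
      also have "\<dots> = \<beta> a b"
        using w[of n] by (simp add: good_def n_def)
      finally show ?thesis
        by (simp add: I_def)
    qed
  qed
qed

text \<open>
  Summability of the total masses of the blocks bounds the masses that accumulate at any one point, so
  that the density is a pointwise convergent series; summability of the other absolute moments allows
  term-by-term integration.
\<close>

lemma ex_density_with_moments:
  fixes \<beta> :: "nat \<Rightarrow> nat \<Rightarrow> real"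
  shows "\<exists>u :: real \<times> real \<Rightarrow> real.
    \<forall>a b. integrable borel_counting (\<lambda>z. u z * monomial a b z) \<and>
      (\<integral>z. u z * monomial a b z \<partial>borel_counting) = \<beta> a b"
proof -
  obtain w :: "nat \<Rightarrow> real \<times> real \<Rightarrow> real" where
    int: "\<And>m a b. integrable borel_counting (\<lambda>z. w m z * monomial a b z)" and
    smm: "\<And>a b. summable (\<lambda>m. \<integral>z. \<bar>w m z * monomial a b z\<bar> \<partial>borel_counting)" and
    mom: "\<And>a b. (\<Sum>m. \<integral>z. w m z * monomial a b z \<partial>borel_counting) = \<beta> a b"
    using ex_atom_blocks[of \<beta>] by blast
  have mono00: "monomial 0 0 = (\<lambda>z. 1)"
    by (auto simp: monomial_def)
  \<comment> \<open>For counting measure, the \<open>L\<^sup>1\<close> norm dominates the supremum norm.\<close>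
  have pointwise: "\<bar>w m p\<bar> \<le> (\<integral>z. \<bar>w m z\<bar> \<partial>borel_counting)" for m p
  proof -
    have "\<bar>w m p\<bar> = (\<integral>z. 1 * indicator {p} z * \<bar>w m z\<bar> \<partial>borel_counting)"
      using has_integral_atom[of 1 p "\<lambda>z. \<bar>w m z\<bar>"] by (simp add: has_bochner_integral_iff)
    also have "\<dots> \<le> (\<integral>z. \<bar>w m z\<bar> \<partial>borel_counting)"
      using has_integral_atom[of 1 p "\<lambda>z. \<bar>w m z\<bar>"] int[of m 0 0]
      by (intro integral_mono) (auto simp: has_bochner_integral_iff mono00 split: split_indicator)
    finally show ?thesis .
  qed
  have smm_abs: "summable (\<lambda>m. \<bar>w m p\<bar>)" for p
  proof (rule summable_comparison_test')
    show "summable (\<lambda>m. \<integral>z. \<bar>w m z\<bar> \<partial>borel_counting)"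
      using smm[of 0 0] by (simp only: mono00 mult_1_right)
    show "norm \<bar>w m p\<bar> \<le> (\<integral>z. \<bar>w m z\<bar> \<partial>borel_counting)" for m
      using pointwise[of m p] by simp
  qed
  have smm_pt: "summable (\<lambda>m. norm (w m p * monomial a b p))" for p a b
    using summable_mult2[OF smm_abs, of p "\<bar>monomial a b p\<bar>"] by (simp add: abs_mult)
  define u where "u = (\<lambda>z. \<Sum>m. w m z)"
  have u: "u z * monomial a b z = (\<Sum>m. w m z * monomial a b z)" for z a b
    unfolding u_def by (rule suminf_mult2) (rule summable_rabs_cancel[OF smm_abs])
  show ?thesis
  proof (intro exI[of _ u] conjI allI)
    show "integrable borel_counting (\<lambda>z. u z * monomial a b z)" for a b
      unfolding u by (rule integrable_suminf) (use int smm smm_pt in auto)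
    show "(\<integral>z. u z * monomial a b z \<partial>borel_counting) = \<beta> a b" for a b
      unfolding u by (subst integral_suminf) (use int smm smm_pt mom in auto)
  qed
qed

theorem theorem3p8:
  fixes \<beta> :: "nat \<Rightarrow> nat \<Rightarrow> real"
  shows "\<exists>\<tau> :: (real \<times> real) set \<Rightarrow> real. interpolating_measure \<beta> \<tau>"
proof -
  obtain u :: "real \<times> real \<Rightarrow> real" where
    int: "\<And>a b. integrable borel_counting (\<lambda>z. u z * monomial a b z)" and
    mom: "\<And>a b. (\<integral>z. u z * monomial a b z \<partial>borel_counting) = \<beta> a b"
    using ex_density_with_moments[of \<beta>] by blast
  let ?\<tau> = "\<lambda>A. LINT z:A|borel_counting. u z"
  have "monomial 0 0 = (\<lambda>z. 1)"
    by (auto simp: monomial_def)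
  then have u: "integrable borel_counting u"
    using int[of 0 0] by (simp only: mult_1_right)
  \<comment> \<open>The variation depends on the reference measure only through its measurable sets, so the
    counting measure can be exchanged for \<open>borel\<close>.\<close>
  have variation: "positive_variation borel_counting \<tau> = positive_variation borel \<tau>"
    for \<tau> :: "(real \<times> real) set \<Rightarrow> real"
    by (simp only: positive_variation_def sets_borel_counting space_borel_counting space_borel)
  have "signed_measure borel ?\<tau>"
    using signed_measure_density[OF u]
    unfolding signed_measure_def sets_borel_counting .
  moreover have "signed_integrable borel ?\<tau> (monomial i j) \<and>
      \<beta> i j = signed_integral borel ?\<tau> (monomial i j)" for i j
  proof -
    have f: "monomial i j \<in> borel_measurable borel_counting"
      by measurable
    show ?thesis
      using signed_integral_density[OF u f int[of i j]]
      unfolding signed_integrable_def signed_integral_def negative_variation_def variation mom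
      by simp
  qed
  ultimately have "interpolating_measure \<beta> ?\<tau>"
    unfolding interpolating_measure_def monomial_def[symmetric] by blast
  then show ?thesis
    by blast
qed

end
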